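(* Let $(X,d)$ be a Hadamard space and let $f:X\times X\to\mathbb{R}$ be a bifunction such that, for constants $\gamma,\eta>0$: (1) $f$ is pseudomonotone: for all $x,y\in X$, $f(x,y)\ge0$ implies $f(y,x)\le 0$; (2) for every $x\in X$, $f(x,\cdot)$ is strongly quasiconvex with modulus $\gamma$; (3) $f(x,z)-f(x,y)-f(y,z)\le\eta\,(d^2(x,y)+d^2(y,z))$ for all $x,y,z\in X$. Let $r:X^3\to\mathbb{R}$ satisfy, for all $u,v,w\in X$, $$r(u,v,w)\le\tfrac12\left(d^2(w,u)-d^2(w,v)-d^2(u,v)\right)\quad\text{and}\quad r(u,v,w)\le d(u,v)\,d(v,w).$$ Let $\beta>0$ and let $\{\beta_k\}_{k\in\mathbb{N}}\subseteq(0,\infty)$ be such that $\beta\le\beta_k$ for all $k\in\mathbb{N}$. Let $x_0\in X$ and consider the method $$x_{k+1}\in S(f_k),\qquad f_k(x,y):=f(x,y)+\frac{1}{\beta_k}r(x_k,x,y)\qquad(k\in\mathbb{N}).$$ Suppose that this method is well-defined (the sets $S(f_k)$ are nonempty) and let $\{x_k\}_k$ be a sequence generated by it. Suppose that $S(f)\ne\emptyset$. Then $\{x_k\}_k$ converges (in the metric $d$) to the unique element $x^*$ of $S(f)$. Further, if $b>0$ satisfies $b^2\ge d^2(x_0,x^* )$, then for all $k>2$ $$d(x_k,x^* )<\frac{D}{\sqrt{k-2}},\qquad\text{where } D:=\frac{4b}{\beta\gamma}.$$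
   Context: A Hadamard space is a complete CAT(0) space (complete geodesic metric space of nonpositive curvature). Such a space is uniquely geodesic, and $(1-\lambda)x\oplus\lambda y$ denotes the point at distance $\lambda d(x,y)$ from $x$ on the unique geodesic joining $x$ to $y$. A function $h:X\to\mathbb{R}$ is strongly quasiconvex with modulus $\gamma>0$ if $h((1-\lambda)x\oplus\lambda y)\le\max\{h(x),h(y)\}-\lambda(1-\lambda)\frac{\gamma}{2}d^2(x,y)$ for all $x,y\in X$, $\lambda\in[0,1]$. For a bifunction $g:X\times X\to\mathbb{R}$, $S(g):=\{z\in X\mid g(z,y)\ge0\text{ for all }y\in X\}$ is the set of equilibrium points of $g$. *)

theory Defs
  imports "HOL-Analysis.Analysis"
begin

definition geodesic_segment :: "'a::metric_space set \<Rightarrow> 'a \<Rightarrow> 'a \<Rightarrow> bool" where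
  "geodesic_segment S x y \<longleftrightarrow>
     (\<exists>c. c 0 = x \<and> c (dist x y) = y \<and>
          (\<forall>s\<in>{0..dist x y}. \<forall>t\<in>{0..dist x y}. dist (c s) (c t) = \<bar>s - t\<bar>) \<and>
          S = c ` {0..dist x y})"

text \<open>
  The CAT(0) condition is stated with comparison triangles in the Euclidean plane. Here
  \<open>x', y', z'\<close> are the vertices of a comparison triangle, and \<open>p', q'\<close> are the comparison points
  of \<open>p\<close> and \<open>q\<close>. Segments are unoriented and any two sides of a triangle share a vertex,
  so it suffices to take \<open>p\<close> and \<open>q\<close> on the sides at \<open>x\<close> (for two points on the same side the
  comparison inequality is an equality); the third side exists as the space is geodesic.
\<close>

class hadamard_space = complete_space +
  assumes geodesic: "\<exists>S. geodesic_segment S x y"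
    and CAT0: "\<lbrakk>geodesic_segment S x y; geodesic_segment T x z; p \<in> S; q \<in> T;
        dist x' y' = dist x y; dist x' z' = dist x z; dist y' z' = dist y z;
        p' \<in> closed_segment x' y'; dist x' p' = dist x p;
        q' \<in> closed_segment x' z'; dist x' q' = dist x q\<rbrakk>
      \<Longrightarrow> dist p q \<le> dist p' (q' :: real^2)"

text \<open>
  \<open>geodesic_comb l x y\<close> is the point \<open>(1 - l) x \<oplus> l y\<close>; it is well-defined for \<open>0 \<le> l \<le> 1\<close>
  since Hadamard spaces are uniquely geodesic.
\<close>

definition geodesic_comb :: "real \<Rightarrow> 'a::hadamard_space \<Rightarrow> 'a \<Rightarrow> 'a" where
  "geodesic_comb l x y =
     (THE z. \<exists>S. geodesic_segment S x y \<and> z \<in> S \<and> dist x z = l * dist x y)"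

definition strongly_quasiconvex :: "real \<Rightarrow> ('a::hadamard_space \<Rightarrow> real) \<Rightarrow> bool" where
  "strongly_quasiconvex \<gamma> h \<longleftrightarrow> \<gamma> > 0 \<and>
     (\<forall>x y. \<forall>l\<in>{0..1}.
        h (geodesic_comb l x y) \<le> max (h x) (h y) - l * (1 - l) * (\<gamma> / 2) * (dist x y)\<^sup>2)"

definition pseudomonotone :: "('a \<Rightarrow> 'a \<Rightarrow> real) \<Rightarrow> bool" where
  "pseudomonotone g \<longleftrightarrow> (\<forall>x y. g x y \<ge> 0 \<longrightarrow> g y x \<le> 0)"

definition equilibrium_points :: "('a \<Rightarrow> 'a \<Rightarrow> real) \<Rightarrow> 'a set" where
  "equilibrium_points g = {z. \<forall>y. g z y \<ge> 0}"

end

theory Submission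
  imports Defs
begin

text \<open>
  Testing \<open>x\<^sub>k\<^sub>+\<^sub>1 \<in> S(f\<^sub>k)\<close> at the solution \<open>x\<^sup>*\<close> and using pseudomonotonicity gives
  \<open>d\<^sup>2(x\<^sub>k\<^sub>+\<^sub>1, x\<^sup>*) + d\<^sup>2(x\<^sub>k, x\<^sub>k\<^sub>+\<^sub>1) \<le> d\<^sup>2(x\<^sub>k, x\<^sup>*)\<close>, so the squared steps sum to at most
  \<open>d\<^sup>2(x\<^sub>0, x\<^sup>*)\<close>. Testing at the midpoint of \<open>x\<^sub>k\<^sub>+\<^sub>1\<close> and \<open>x\<^sup>*\<close> and using strong quasiconvexity
  gives \<open>d(x\<^sub>k\<^sub>+\<^sub>1, x\<^sup>*) \<le> 4 / (\<beta> \<gamma>) d(x\<^sub>k, x\<^sub>k\<^sub>+\<^sub>1)\<close>. As the distances to \<open>x\<^sup>*\<close> decrease, summation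
  yields \<open>k d\<^sup>2(x\<^sub>k, x\<^sup>*) \<le> (4 / (\<beta> \<gamma>))\<^sup>2 d\<^sup>2(x\<^sub>0, x\<^sup>*)\<close>.
\<close>

text \<open>Points at the same distance from \<open>x\<close> share one comparison point, even if
  they lie on different segments. Hence the description in \<open>geodesic_comb\<close> is
  unambiguous.\<close>

lemma geodesic_segment_point_unique:
  fixes x y :: "'a::hadamard_space"
  assumes "geodesic_segment S x y" "geodesic_segment T x y" "p \<in> S" "q \<in> T"
    and pl: "dist x p = l * dist x y" and ql: "dist x q = l * dist x y" and l: "0 \<le> l" "l \<le> 1"
  shows "p = q"
proof -
  define e :: "real^2" where "e = axis 1 1"
  define y' where "y' = dist x y *\<^sub>R e"
  have norm_e: "norm e = 1"
    by (simp add: e_def)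
  have mem: "l *\<^sub>R y' \<in> closed_segment 0 y'"
    using l by (auto simp: closed_segment_def)
  have "dist 0 y' = dist x y"
    by (simp add: y'_def norm_e)
  moreover have "dist 0 (l *\<^sub>R y') = l * dist x y"
    using l by (simp add: y'_def norm_e)
  ultimately have "dist p q \<le> dist (l *\<^sub>R y') (l *\<^sub>R y')"
    \<comment> \<open>the comparison triangle is degenerate, with vertices \<open>0, y', y'\<close>\<close>
    using pl ql mem
    by (intro CAT0[where x' = 0 and y' = y' and z' = y', OF assms(1-4)]) auto
  then show ?thesis
    by simp
qed

text \<open>The arc-length parametrization of a segment at \<open>l * dist x y\<close> supplies a
  point, and uniqueness justifies the definite description.\<close>

lemma dist_geodesic_comb:
  fixes x y :: "'a::hadamard_space"
  assumes l: "0 \<le> l" "l \<le> 1"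
  shows "dist x (geodesic_comb l x y) = l * dist x y"
proof -
  obtain S c where S: "geodesic_segment S x y" and c: "c 0 = x"
    "\<forall>s\<in>{0..dist x y}. \<forall>t\<in>{0..dist x y}. dist (c s) (c t) = \<bar>s - t\<bar>" "S = c ` {0..dist x y}"
    using geodesic[of x y] unfolding geodesic_segment_def by blast
  have t: "l * dist x y \<in> {0..dist x y}"
    using l by (auto simp: mult_left_le_one_le)
  have d: "dist x (c (l * dist x y)) = l * dist x y"
    using c(2)[rule_format, of 0 "l * dist x y"] t c(1) by auto
  have "\<exists>!z. \<exists>S. geodesic_segment S x y \<and> z \<in> S \<and> dist x z = l * dist x y"
  proof
    show "\<exists>S. geodesic_segment S x y \<and> c (l * dist x y) \<in> S
        \<and> dist x (c (l * dist x y)) = l * dist x y"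
      using S c(3) t d by blast
    show "z = c (l * dist x y)"
      if "\<exists>T. geodesic_segment T x y \<and> z \<in> T \<and> dist x z = l * dist x y" for z
      using that S c(3) t d l by (auto intro: geodesic_segment_point_unique)
  qed
  from theI'[OF this] show ?thesis
    unfolding geodesic_comb_def by blast
qed

lemma strongly_quasiconvex_midpoint:
  assumes "strongly_quasiconvex \<gamma> h"
  shows "h (geodesic_comb (1/2) x y) \<le> max (h x) (h y) - \<gamma> / 8 * (dist x y)\<^sup>2"
proof -
  have "h (geodesic_comb (1/2) x y)
      \<le> max (h x) (h y) - 1/2 * (1 - 1/2) * (\<gamma> / 2) * (dist x y)\<^sup>2"
    using assms[unfolded strongly_quasiconvex_def, THEN conjunct2, rule_format, of "1/2" x y] by auto
  then show ?thesis
    by simp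
qed

text \<open>If \<open>y \<noteq> z\<close>, then \<open>f y\<close> is at most 0 at both
  \<open>y\<close> and \<open>z\<close>, so strong quasiconvexity makes it negative at their
  midpoint.\<close>

lemma equilibrium_points_unique:
  assumes "pseudomonotone f" and sq: "\<And>u. strongly_quasiconvex \<gamma> (f u)"
    and refl: "\<And>u. f u u = 0"
    and y: "y \<in> equilibrium_points f" and z: "z \<in> equilibrium_points f"
  shows "y = z"
proof (rule ccontr)
  assume "y \<noteq> z"
  have "f y z \<le> 0"
    using assms by (auto simp: equilibrium_points_def pseudomonotone_def)
  moreover have "f y (geodesic_comb (1/2) y z) \<le> max (f y y) (f y z) - \<gamma> / 8 * (dist y z)\<^sup>2"
    using strongly_quasiconvex_midpoint[OF sq] .
  moreover have "\<gamma> / 8 * (dist y z)\<^sup>2 > 0"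
    using sq[of y] \<open>y \<noteq> z\<close> unfolding strongly_quasiconvex_def
    by (intro mult_pos_pos) auto
  ultimately have "f y (geodesic_comb (1/2) y z) < 0"
    using refl[of y] by linarith
  moreover have "f y (geodesic_comb (1/2) y z) \<ge> 0"
    using y by (auto simp: equilibrium_points_def)
  ultimately show False
    by linarith
qed

theorem theorem5p10:
  fixes f :: "'a::hadamard_space \<Rightarrow> 'a \<Rightarrow> real"
    and r :: "'a \<Rightarrow> 'a \<Rightarrow> 'a \<Rightarrow> real"
    and \<gamma> \<eta> \<beta> :: real
    and \<beta>s :: "nat \<Rightarrow> real"
    and x :: "nat \<Rightarrow> 'a"
  assumes "\<gamma> > 0" and "\<eta> > 0"
    and "pseudomonotone f"
    and "\<And>u. strongly_quasiconvex \<gamma> (f u)"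
    and "\<And>u v w. f u w - f u v - f v w \<le> \<eta> * ((dist u v)\<^sup>2 + (dist v w)\<^sup>2)"
    and "\<And>u v w. r u v w \<le> 1 / 2 * ((dist w u)\<^sup>2 - (dist w v)\<^sup>2 - (dist u v)\<^sup>2)"
    and "\<And>u v w. r u v w \<le> dist u v * dist v w"
    and "\<beta> > 0" and "\<And>k. \<beta>s k > 0" and "\<And>k. \<beta> \<le> \<beta>s k"
    and "\<And>k. x (Suc k) \<in> equilibrium_points (\<lambda>u v. f u v + 1 / \<beta>s k * r (x k) u v)"
    and "equilibrium_points f \<noteq> {}"
  shows "\<exists>xstar. equilibrium_points f = {xstar} \<and> x \<longlonglongrightarrow> xstar \<and>
           (\<forall>b>0. b\<^sup>2 \<ge> (dist (x 0) xstar)\<^sup>2 \<longrightarrow>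
             (\<forall>k>2. dist (x k) xstar < (4 * b / (\<beta> * \<gamma>)) / sqrt (real k - 2)))"
proof -
  \<comment> \<open>With all three points equal, the Lipschitz-type condition reads
    \<open>- f u u \<le> 0\<close>; pseudomonotonicity excludes \<open>f u u > 0\<close>.\<close>
  have refl: "f u u = 0" for u
    using assms(3) assms(5)[of u u u] by (force simp: pseudomonotone_def)
  obtain z where z: "z \<in> equilibrium_points f"
    using assms(12) by blast
  have S: "equilibrium_points f = {z}"
    using equilibrium_points_unique[OF assms(3,4) refl] z by blast
  have fz: "f u z \<le> 0" for u
    using z assms(3) by (auto simp: equilibrium_points_def pseudomonotone_def)
  have step: "0 \<le> f (x (Suc k)) v + 1 / \<beta>s k * r (x k) (x (Suc k)) v" for k v
    using assms(11)[of k] by (auto simp: equilibrium_points_def)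
  have fejer: "(dist (x (Suc k)) z)\<^sup>2 + (dist (x k) (x (Suc k)))\<^sup>2 \<le> (dist (x k) z)\<^sup>2" for k
  proof -
    have "0 \<le> 1 / \<beta>s k * r (x k) (x (Suc k)) z"
      using step[of k z] fz[of "x (Suc k)"] by linarith
    then have "0 \<le> r (x k) (x (Suc k)) z"
      using assms(9)[of k] by (simp add: zero_le_divide_iff)
    then show ?thesis
      using assms(6)[of "x k" "x (Suc k)" z] by (simp add: dist_commute)
  qed
  define C where "C = 4 / (\<beta> * \<gamma>)"
  have "C > 0"
    using assms(1,8) by (simp add: C_def)
  have contr: "dist (x (Suc k)) z \<le> C * dist (x k) (x (Suc k))" for k
  \<comment> \<open>Away from \<open>z\<close> the factor \<open>E / 2\<close> is positive and can
    be cancelled below.\<close>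
  proof (cases "x (Suc k) = z")
    case True
    then show ?thesis using \<open>C > 0\<close> by simp
  next
    case False
    define u where "u = x (Suc k)"
    define m where "m = geodesic_comb (1/2) u z"
    define D where "D = dist (x k) u"
    define E where "E = dist u z"
    have "E > 0"
      using False by (simp add: E_def u_def)
    have "dist u m = E / 2"
      using dist_geodesic_comb[of "1/2" u z] by (simp add: m_def E_def)
    then have "r (x k) u m \<le> D * (E / 2)"
      using assms(7)[of "x k" u m] by (simp only: D_def)
    then have "1 / \<beta>s k * r (x k) u m \<le> 1 / \<beta>s k * (D * (E / 2))"
      using assms(9)[of k] by (intro mult_left_mono) auto
    also have "\<dots> \<le> 1 / \<beta> * (D * (E / 2))"
      using assms(8,9,10) \<open>E > 0\<close> by (intro mult_right_mono frac_le) (auto simp: D_def)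
    finally have "1 / \<beta>s k * r (x k) u m \<le> 1 / \<beta> * (D * (E / 2))" .
    moreover have "f u m \<le> max (f u u) (f u z) - \<gamma> / 8 * E\<^sup>2"
      unfolding m_def E_def by (rule strongly_quasiconvex_midpoint[OF assms(4)])
    \<comment> \<open>The maximum is 0 because \<open>f u u = 0\<close> and
      \<open>f u z \<le> 0\<close>.\<close>
    ultimately have "\<gamma> / 8 * E\<^sup>2 \<le> 1 / \<beta> * (D * (E / 2))"
      using step[of k m] refl[of u] fz[of u] by (simp add: u_def)
    then have "(\<gamma> / 4 * E) * (E / 2) \<le> (D / \<beta>) * (E / 2)"
      by (simp add: power2_eq_square)
    then have "\<gamma> / 4 * E \<le> D / \<beta>"
      by (rule mult_right_le_imp_le) (use \<open>E > 0\<close> in simp)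
    then show ?thesis
      using assms(1,8) by (simp add: C_def D_def E_def u_def field_simps)
  qed
  have antimono: "(dist (x (Suc k)) z)\<^sup>2 \<le> (dist (x k) z)\<^sup>2" for k
    using fejer[of k] zero_le_power2[of "dist (x k) (x (Suc k))"] by linarith
  \<comment> \<open>The extra term \<open>C\<^sup>2 * (dist (x k) z)\<^sup>2\<close> carries the
    telescoping sum: in each step \<open>fejer\<close> lowers it by \<open>C\<^sup>2\<close> times
    the squared step length, which by \<open>contr\<close> pays for one more copy of the squared
    distance.\<close>
  have key: "real k * (dist (x k) z)\<^sup>2 + C\<^sup>2 * (dist (x k) z)\<^sup>2 \<le> C\<^sup>2 * (dist (x 0) z)\<^sup>2" for k
  proof (induction k)
    case (Suc k)
    have "(dist (x (Suc k)) z)\<^sup>2 \<le> C\<^sup>2 * (dist (x k) (x (Suc k)))\<^sup>2"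
      using power_mono[OF contr[of k], of 2] by (simp add: power_mult_distrib)
    moreover have "C\<^sup>2 * (dist (x (Suc k)) z)\<^sup>2 + C\<^sup>2 * (dist (x k) (x (Suc k)))\<^sup>2
        \<le> C\<^sup>2 * (dist (x k) z)\<^sup>2"
      using mult_left_mono[OF fejer[of k], of "C\<^sup>2"] by (simp add: distrib_left)
    moreover have "real k * (dist (x (Suc k)) z)\<^sup>2 \<le> real k * (dist (x k) z)\<^sup>2"
      using antimono by (intro mult_left_mono) auto
    ultimately show ?case
      using Suc.IH by (simp add: distrib_right)
  qed simp
  \<comment> \<open>Allowing \<open>b = 0\<close> lets the convergence proof take
    \<open>b = dist (x 0) z\<close> even when \<open>x 0 = z\<close>.\<close>
  have rate: "dist (x k) z \<le> C * b / sqrt k"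
    if "b \<ge> 0" "b\<^sup>2 \<ge> (dist (x 0) z)\<^sup>2" "k > 0" for b k
  proof -
    have "real k * (dist (x k) z)\<^sup>2 \<le> C\<^sup>2 * (dist (x 0) z)\<^sup>2"
      using key[of k] zero_le_power2[of "C * dist (x k) z"]
      unfolding power_mult_distrib by linarith
    also have "\<dots> \<le> C\<^sup>2 * b\<^sup>2"
      using that by (intro mult_left_mono) auto
    finally have "(sqrt k * dist (x k) z)\<^sup>2 \<le> (C * b)\<^sup>2"
      by (simp add: power_mult_distrib)
    then have "sqrt k * dist (x k) z \<le> C * b"
      by (rule power2_le_imp_le) (use that \<open>C > 0\<close> in auto)
    then show ?thesis
      using that by (simp add: field_simps)
  qed
  have "(\<lambda>k. dist (x k) z) \<longlonglongrightarrow> 0"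
  proof (rule tendsto_sandwich[where f = "\<lambda>_. 0"])
    show "\<forall>\<^sub>F k in sequentially. dist (x k) z \<le> C * dist (x 0) z / sqrt (real k)"
      using eventually_gt_at_top[of 0] by eventually_elim (use rate in auto)
    show "(\<lambda>k. C * dist (x 0) z / sqrt (real k)) \<longlonglongrightarrow> 0"
      by (intro tendsto_divide_0[OF tendsto_const] filterlim_at_top_imp_at_infinity
          filterlim_compose[OF sqrt_at_top filterlim_real_sequentially])
  qed auto
  then have lim: "x \<longlonglongrightarrow> z"
    using tendsto_dist_iff by blast
  have "dist (x k) z < (4 * b / (\<beta> * \<gamma>)) / sqrt (real k - 2)"
    if "b > 0" "b\<^sup>2 \<ge> (dist (x 0) z)\<^sup>2" "k > 2" for b k
  proof -
    have "dist (x k) z \<le> C * b / sqrt k"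
      using rate that by simp
    \<comment> \<open>The strict inequality comes from \<open>0 < k - 2 < k\<close> and
      \<open>C * b > 0\<close>.\<close>
    also have "\<dots> < C * b / sqrt (real k - 2)"
      using that \<open>C > 0\<close> by (intro divide_strict_left_mono mult_pos_pos) auto
    finally show ?thesis
      by (simp add: C_def)
  qed
  with S lim show ?thesis
    by blast
qed

end
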